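(* Let $n \ge 3$ be an integer. There exist constants $c_1(n) > 0$ and $Q_0(n) > 0$, depending only on $n$, such that for every real $Q > Q_0(n)$ and every real $v$ with $1.4 \le v \le \frac{7}{16}(n+1)$ we have \[ \# \mathcal{P}_n(Q,v,I_0) \le c_1(n)\, Q^{\,n+1-\frac{v}{7}} . \]
   Context: For a polynomial $P(x) = a_n x^n + \dots + a_1 x + a_0 \in \mathbb{C}[x]$ its height is $H(P) = \max_{0 \le i \le n} |a_i|$. Let $I_0 = \left(-\tfrac12, \tfrac12\right)$. For an integer $n \ge 1$, reals $Q \ge 1$, $v \ge 0$ and a set $D \subseteq \mathbb{C}$, let $\mathcal{P}_n(Q,v,D)$ denote the set of primitive irreducible polynomials $P \in \mathbb{Z}[x]$ with $\deg P = n$ exactly, $H(P) \le Q$, positive leading coefficient, and having a root $\alpha \in D$ such that $|P'(\alpha)| < Q^{1-v}$. (Equivalently, this counts algebraic numbers $\alpha$ of degree $n$ and height at most $Q$ in $D$ whose minimal polynomial has small derivative at $\alpha$.) *)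

theory Defs
  imports "HOL-Analysis.Analysis" "HOL-Computational_Algebra.Computational_Algebra"
begin

definition height :: "int poly \<Rightarrow> real" where
  "height P = Max {\<bar>real_of_int (coeff P i)\<bar> | i. i \<le> degree P}"

definition I0 :: "complex set" where
  "I0 = complex_of_real ` {-1/2<..<1/2}"

definition Pset :: "nat \<Rightarrow> real \<Rightarrow> real \<Rightarrow> complex set \<Rightarrow> int poly set" where
  "Pset n Q v D = {P :: int poly.
      content P = 1 \<and> irreducible P \<and> degree P = n \<and> height P \<le> Q \<and> lead_coeff P > 0 \<and>
      (\<exists>\<alpha>\<in>D. poly (map_poly of_int P) \<alpha> = (0::complex) \<and>
              norm (poly (pderiv (map_poly of_int P)) \<alpha>) < Q powr (1 - v))}"

end

theory Submission
  imports Defs "Subresultants.Subresultant_Gcd" "Berlekamp_Zassenhaus.Mahler_Measure"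
begin

text \<open>
  Cover \<open>I0\<close> by about \<open>Q powr v\<close> discs of radius \<open>\<delta> = Q powr (-v)\<close>. A polynomial counted by
  \<open>Pset\<close> with its root in the disc around \<open>x\<close> is \<open>O(Q \<delta>\<^sup>2)\<close> on that disc, that is, it behaves
  as if it had two roots there. To a nonzero \<open>F \<in> \<int>[X]\<close> attach the vector \<open>(d, h, c)\<close> of its degree, a
  logarithmic Mahler measure, and \<open>- ln \<delta>\<close> times the number of roots in the disc (roots at
  intermediate distances counted fractionally). All three are additive on products, and since the
  resultant of coprime \<open>F\<close>, \<open>G\<close> is a nonzero integer,
  \<open>d F * h G + d G * h F - c F * c G / (- ln \<delta>) \<ge> 0\<close>. This quadratic form plays the role of the
  intersection form on a surface. For a set \<open>A\<close> of polynomials whose differences have vector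
  bounded by \<open>D = (k, L, t)\<close> and have no common factor, \<open>D\<close> is nef, and \<open>ln (card A)\<close> is bounded by
  \<open>D\<^sup>2 / 2\<close> up to \<open>2 * L\<close>, as Riemann-Roch predicts: fixing one more leading coefficient lowers both
  sides by \<open>L\<close>, and when the remaining differences acquire a common factor \<open>G\<close>, one
  divides by it; nefness before and after the division shows that \<open>D\<^sup>2 / 2\<close> does not grow by more
  than the slack. Irreducibility is used only to see that two different polynomials of \<open>Pset\<close> are
  coprime. Each disc then contains at most \<open>1 + O(Q powr (n + 2 - 2 * v))\<close> polynomials.
\<close>

hide_const (open) UnivPoly.coeff Module.smult

section \<open>The resultant in terms of roots\<close>

lemma cmod_poly_eq_prod_roots:
  fixes q :: "complex poly"
  shows "cmod (poly q z) = cmod (lead_coeff q) * (\<Prod>\<beta>\<in>#proots q. cmod (z - \<beta>))"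
proof -
  have "poly q z = poly (smult (lead_coeff q) (\<Prod>x\<in>#proots q. [:-x, 1:])) z"
    by (simp only: complex_poly_decompose_multiset)
  also have "\<dots> = lead_coeff q * (\<Prod>x\<in>#proots q. z - x)"
    by (simp add: poly_prod_mset image_mset.compositionality o_def)
  also have "cmod \<dots> = cmod (lead_coeff q) * (\<Prod>\<beta>\<in>#proots q. cmod (z - \<beta>))"
  proof -
    have "cmod (\<Prod>x\<in>#M. z - x) = (\<Prod>\<beta>\<in>#M. cmod (z - \<beta>))" for M
      by (induction M) (auto simp: norm_mult)
    thus ?thesis by (simp add: norm_mult)
  qed
  finally show ?thesis .
qed

text \<open>Absolute value of the resultant as a product over pairs of roots; without the sign it is
  symmetric.\<close>

definition res_abs :: "complex poly \<Rightarrow> complex poly \<Rightarrow> real" where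
  "res_abs p q = cmod (lead_coeff p) ^ degree q * cmod (lead_coeff q) ^ degree p *
     (\<Prod>\<alpha>\<in>#proots p. \<Prod>\<beta>\<in>#proots q. cmod (\<alpha> - \<beta>))"

lemma res_abs_commute: "res_abs p q = res_abs q p"
proof -
  have "(\<Prod>\<alpha>\<in>#proots p. \<Prod>\<beta>\<in>#proots q. cmod (\<alpha> - \<beta>)) = (\<Prod>\<beta>\<in>#proots q. \<Prod>\<alpha>\<in>#proots p. cmod (\<beta> - \<alpha>))"
    by (subst prod_mset.swap) (simp add: norm_minus_commute)
  thus ?thesis by (simp add: res_abs_def)
qed

text \<open>In this form \<open>q\<close> enters only through its degree and its values at the roots
  of \<open>p\<close>, so reducing \<open>q\<close> modulo \<open>p\<close> changes only the power
  of \<open>lead_coeff p\<close>.\<close>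

lemma res_abs_eval: "res_abs p q = cmod (lead_coeff p) ^ degree q * (\<Prod>\<alpha>\<in>#proots p. cmod (poly q \<alpha>))"
proof -
  have "(\<Prod>\<alpha>\<in>#M. cmod (poly q \<alpha>)) =
      cmod (lead_coeff q) ^ size M * (\<Prod>\<alpha>\<in>#M. \<Prod>\<beta>\<in>#proots q. cmod (\<alpha> - \<beta>))" for M
    by (induction M) (auto simp: cmod_poly_eq_prod_roots)
  thus ?thesis by (simp add: res_abs_def size_proots_complex)
qed

text \<open>Euclidean algorithm: replacing \<open>q\<close> by \<open>r = q mod p\<close> divides
  both sides by \<open>cmod (lead_coeff p) ^ (degree q - degree r)\<close>, and \<open>q\<close> and
  \<open>r\<close> agree at the roots of \<open>p\<close>. A nonzero resultant keeps
  \<open>r\<close> nonzero.\<close>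

lemma cmod_resultant_le_degree:
  fixes p q :: "complex poly"
  assumes "degree p \<le> degree q" "p \<noteq> 0" "q \<noteq> 0" "resultant p q \<noteq> 0"
  shows "cmod (resultant p q) = res_abs p q"
  using assms
proof (induction "degree p" arbitrary: p q rule: less_induct)
  case less
  show ?case
  proof (cases "degree p = 0")
    case True
    then obtain c where p: "p = [:c:]" using degree_eq_zeroE by blast
    thus ?thesis by (simp add: res_abs_def norm_power)
  next
    case False
    define r where "r = q mod p"
    have eq: "q + (- (q div p)) * p = r"
      unfolding r_def by (simp add: minus_div_mult_eq_mod[symmetric])
    have res: "resultant p q = (-1) ^ (degree p * degree q) * resultant q p"
      by (rule resultant_swap)
    have r0: "r \<noteq> 0"
    proof
      assume "r = 0"
      hence "q = (q div p) * p" using eq by (simp add: algebra_simps)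
      from subresultant_product[OF this less.prems(1), of 0] False
      have "resultant q p = 0" by (simp add: subresultant_resultant)
      thus False using res less.prems(4) by simp
    qed
    have deg: "degree r < degree p"
      using degree_mod_less[OF less.prems(2), of q] r0 unfolding r_def by auto
    \<comment> \<open>The rule for subresultants of index below \<open>degree r\<close> gives index
      0 unless \<open>r\<close> is constant; a constant \<open>r\<close> falls under the rule for
      index \<open>degree r\<close>. The signs are collected in \<open>s\<close>.\<close>
    have main: "\<exists>s. cmod s = 1 \<and> resultant q p = s * lead_coeff p ^ (degree q - degree r) * resultant p r"
    proof (cases "degree r = 0")
      case True
      then obtain c where c: "r = [:c:]" using degree_eq_zeroE by blast
      hence c0: "c \<noteq> 0" using r0 by auto
      have "subresultant (degree r) q p = smult ((-1)^((degree q - degree r) * (degree p - degree r))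
          * lead_coeff p ^ (degree q - degree r) * lead_coeff r ^ (degree p - degree r - 1)) r"
        by (rule BT_lemma_1_13[OF eq less.prems(1)]) (use deg in auto)
      hence "resultant q p = ((-1)^((degree q - degree r) * (degree p - degree r))
          * lead_coeff p ^ (degree q - degree r) * c ^ (degree p - 1)) * c"
        using True by (simp add: subresultant_resultant c)
      also have "\<dots> = (-1)^((degree q - degree r) * (degree p - degree r))
          * lead_coeff p ^ (degree q - degree r) * resultant p r"
        using False by (simp add: c power_eq_if[of c "degree p"])
      finally show ?thesis by (intro exI[of _ "(-1)^((degree q - degree r) * (degree p - degree r))"])
          (simp add: norm_power)
    next
      case False
      have "subresultant 0 q p = smult ((-1)^((degree q - 0) * (degree p - 0))
          * lead_coeff p ^ (degree q - degree r)) (subresultant 0 p r)"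
        by (rule BT_lemma_1_12[OF eq less.prems(1)]) (use deg False in auto)
      hence "resultant q p = (-1)^(degree q * degree p)
          * lead_coeff p ^ (degree q - degree r) * resultant p r"
        by (simp add: subresultant_resultant)
      thus ?thesis by (intro exI[of _ "(-1)^(degree q * degree p)"]) (simp add: norm_power)
    qed
    then obtain s where s: "cmod s = 1"
      "resultant q p = s * lead_coeff p ^ (degree q - degree r) * resultant p r" by blast
    have rpr: "resultant p r = (-1) ^ (degree p * degree r) * resultant r p"
      by (rule resultant_swap)
    have "resultant r p \<noteq> 0" using less.prems(4) res s(2) rpr by auto
    hence "cmod (resultant r p) = res_abs r p"
      using less.hyps[OF deg] deg r0 less.prems(2) by auto
    hence "cmod (resultant p q) = cmod (lead_coeff p) ^ (degree q - degree r) * res_abs p r"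
      by (simp add: res s rpr norm_mult norm_power res_abs_commute[of p r])
    also have "\<dots> = cmod (lead_coeff p) ^ ((degree q - degree r) + degree r) *
        (\<Prod>\<alpha>\<in>#proots p. cmod (poly r \<alpha>))"
      by (simp only: res_abs_eval power_add mult.assoc)
    also have "(\<Prod>\<alpha>\<in>#proots p. cmod (poly r \<alpha>)) = (\<Prod>\<alpha>\<in>#proots p. cmod (poly q \<alpha>))"
    proof (intro arg_cong[of _ _ prod_mset] image_mset_cong)
      fix \<alpha> assume "\<alpha> \<in># proots p"
      hence "poly p \<alpha> = 0" using less.prems(2) by simp
      thus "cmod (poly r \<alpha>) = cmod (poly q \<alpha>)" unfolding eq[symmetric] by simp
    qed
    also have "cmod (lead_coeff p) ^ ((degree q - degree r) + degree r) * \<dots> = res_abs p q"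
      using deg less.prems(1) by (simp add: res_abs_eval)
    finally show ?thesis .
  qed
qed

lemma cmod_resultant:
  fixes p q :: "complex poly"
  assumes "p \<noteq> 0" "q \<noteq> 0" "resultant p q \<noteq> 0"
  shows "cmod (resultant p q) = res_abs p q"
proof (cases "degree p \<le> degree q")
  case True
  thus ?thesis using cmod_resultant_le_degree assms by blast
next
  case False
  have "resultant q p \<noteq> 0" "cmod (resultant p q) = cmod (resultant q p)"
    using assms(3) resultant_swap[of p q] by (auto simp: norm_mult norm_power)
  thus ?thesis using cmod_resultant_le_degree[of q p] False assms
    by (simp add: res_abs_commute)
qed

text \<open>A prime that does not divide \<open>R\<close> is coprime to it, so the resultant is a
  nonzero integer.\<close>

lemma res_abs_int_ge_1:
  fixes S R :: "int poly"
  assumes "prime S" "R \<noteq> 0" "\<not> S dvd R" "degree S > 0"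
  shows "1 \<le> res_abs (of_int_poly S) (of_int_poly R)"
proof -
  have "algebraic_semidom_class.coprime S R" by (rule prime_imp_coprime) (use assms in auto)
  hence "gcd S R = 1" by simp
  hence nz: "resultant S R \<noteq> 0" by (simp add: resultant_0_gcd)
  have eq: "resultant (of_int_poly S) (of_int_poly R) = complex_of_int (resultant S R)"
    by (rule of_int_hom.resultant_hom)
  have "res_abs (of_int_poly S) (of_int_poly R) = cmod (complex_of_int (resultant S R))"
    using cmod_resultant[of "of_int_poly S" "of_int_poly R"] assms nz eq by auto
  thus ?thesis using nz by simp
qed

section \<open>Mahler measures relative to a disc\<close>

text \<open>The factor 2 absorbs the one in \<open>\<bar>\<alpha> - \<beta>\<bar> \<le> 2 * max \<bar>\<alpha> - x\<bar> \<bar>\<beta> - x\<bar>\<close>, so that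
  the resultant inequality below holds without error terms.\<close>

definition log_measure :: "complex \<Rightarrow> real \<Rightarrow> int poly \<Rightarrow> real" where
  "log_measure x r F = ln \<bar>real_of_int (lead_coeff F)\<bar> +
     (\<Sum>\<alpha>\<in>#proots (of_int_poly F). ln (2 * max r (cmod (\<alpha> - x))))"

lemma log_measure_mult:
  assumes "F \<noteq> 0" "G \<noteq> 0"
  shows "log_measure x r (F * G) = log_measure x r F + log_measure x r G"
  using assms
  by (simp add: log_measure_def lead_coeff_mult abs_mult ln_mult proots_mult
      of_int_poly_hom.hom_mult)

lemma log_measure_const:
  assumes "degree F = 0"
  shows "log_measure x r F = ln \<bar>real_of_int (lead_coeff F)\<bar>"
proof -
  obtain c where "F = [:c:]" using assms degree_eq_zeroE by blast
  moreover have "of_int_poly [:c:] = [:of_int c :: complex:]"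
    by (intro poly_eqI) (simp add: coeff_map_poly coeff_pCons split: nat.split)
  ultimately show ?thesis by (simp add: log_measure_def)
qed

lemma ln_lead_coeff_nonneg:
  assumes "F \<noteq> 0"
  shows "0 \<le> ln \<bar>real_of_int (lead_coeff F)\<bar>"
proof -
  have "lead_coeff F \<noteq> 0" using assms by simp
  hence "1 \<le> \<bar>lead_coeff F\<bar>" by linarith
  hence "1 \<le> \<bar>real_of_int (lead_coeff F)\<bar>" by linarith
  thus ?thesis by simp
qed

lemma sum_mset_lower: "(\<And>a. 0 \<le> (w a :: real)) \<Longrightarrow> 0 \<le> (\<Sum>a\<in>#M. w a)"
  by (induction M) (auto simp: add_nonneg_nonneg)

lemma sum_mset_upper: "(\<And>a. w a \<le> (c :: real)) \<Longrightarrow> (\<Sum>a\<in>#M. w a) \<le> c * size M"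
  by (induction M) (auto simp: algebra_simps intro: add_mono)

lemma sum_mset_diff: "(\<Sum>a\<in>#M. (f a :: real)) - (\<Sum>a\<in>#M. g a) = (\<Sum>a\<in>#M. f a - g a)"
  by (induction M) auto

text \<open>At radius 1 every root contributes at least \<open>ln 2\<close>, so a bound on the
  measure also bounds the leading coefficient.\<close>

lemma ln_lead_coeff_le_log_measure:
  assumes "F \<noteq> 0" shows "ln \<bar>real_of_int (lead_coeff F)\<bar> \<le> log_measure x 1 F"
  unfolding log_measure_def by (simp add: sum_mset_lower)

lemma log_measure_nonneg: "F \<noteq> 0 \<Longrightarrow> 0 \<le> log_measure x 1 F"
  using ln_lead_coeff_le_log_measure ln_lead_coeff_nonneg order_trans by blast

lemma ln_prod_mset:
  assumes "\<And>a. a \<in># M \<Longrightarrow> 0 < (f a :: real)"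
  shows "ln (\<Prod>a\<in>#M. f a) = (\<Sum>a\<in>#M. ln (f a))" "0 < (\<Prod>a\<in>#M. f a)"
proof -
  have "ln (\<Prod>a\<in>#M. f a) = (\<Sum>a\<in>#M. ln (f a)) \<and> 0 < (\<Prod>a\<in>#M. f a)"
    using assms
  proof (induction M)
    case (add b M)
    hence "ln (\<Prod>a\<in>#M. f a) = (\<Sum>a\<in>#M. ln (f a))" "0 < (\<Prod>a\<in>#M. f a)" "0 < f b" by auto
    thus ?case by (simp add: ln_mult_pos)
  qed simp
  thus "ln (\<Prod>a\<in>#M. f a) = (\<Sum>a\<in>#M. ln (f a))" "0 < (\<Prod>a\<in>#M. f a)" by auto
qed

section \<open>Upper bounds from coefficients, through the Mahler measure\<close>

text \<open>The substitution moves a root \<open>\<alpha>\<close> to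
  \<open>(\<alpha> - x) / r\<close> and multiplies the leading coefficient by one factor
  \<open>r\<close> per root; that factor turns \<open>max 1 (cmod (\<alpha> - x) / r)\<close> into
  \<open>max r (cmod (\<alpha> - x))\<close>.\<close>

lemma mahler_pcompose:
  fixes p :: "complex poly"
  assumes "r > 0"
  shows "mahler_measure_poly (p \<circ>\<^sub>p [:x, of_real r:]) =
    cmod (lead_coeff p) * (\<Prod>\<alpha>\<in>#proots p. max r (cmod (\<alpha> - x)))"
proof -
  obtain as where as: "mset as = proots p" using ex_mset by blast
  have "p = smult (lead_coeff p) (\<Prod>x\<in>#proots p. [:-x, 1:])"
    by (simp only: complex_poly_decompose_multiset)
  also have "\<dots> = smult (lead_coeff p) (\<Prod>\<alpha>\<leftarrow>as. [:-\<alpha>, 1:])"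
    by (simp only: as[symmetric] mset_map[symmetric] prod_mset_prod_list)
  finally have p: "p = smult (lead_coeff p) (\<Prod>\<alpha>\<leftarrow>as. [:-\<alpha>, 1:])" .
  have prod: "(\<Prod>\<alpha>\<leftarrow>as. [:-\<alpha>, 1:]) \<circ>\<^sub>p [:x, of_real r:] =
      smult (of_real r ^ length as) (\<Prod>\<alpha>\<leftarrow>map (\<lambda>\<alpha>. (\<alpha> - x) / of_real r) as. [:-\<alpha>, 1:])" for as
  proof (induction as)
    case (Cons a as)
    have "[:-a, 1:] \<circ>\<^sub>p [:x, of_real r:] = smult (of_real r) [:- ((a - x) / of_real r), 1:]"
      using assms by (simp add: pcompose_pCons)
    hence "(\<Prod>\<alpha>\<leftarrow>a # as. [:-\<alpha>, 1:]) \<circ>\<^sub>p [:x, of_real r:] =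
      smult (of_real r) [:- ((a - x) / of_real r), 1:] *
       smult (of_real r ^ length as) (\<Prod>\<alpha>\<leftarrow>map (\<lambda>\<alpha>. (\<alpha> - x) / of_real r) as. [:-\<alpha>, 1:])"
      by (simp only: list.map prod_list.Cons pcompose_mult Cons.IH)
    thus ?case by (simp only: mult_smult_left mult_smult_right smult_smult list.map prod_list.Cons
       list.size power_Suc mult.commute One_nat_def add_0_right add_Suc_right)
  qed (simp add: pcompose_1)
  have "p \<circ>\<^sub>p [:x, of_real r:] = smult (lead_coeff p * of_real r ^ length as)
      (\<Prod>\<alpha>\<leftarrow>map (\<lambda>\<alpha>. (\<alpha> - x) / of_real r) as. [:-\<alpha>, 1:])"
    by (subst p) (simp only: pcompose_smult prod smult_smult)
  hence "mahler_measure_poly (p \<circ>\<^sub>p [:x, of_real r:]) =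
     cmod (lead_coeff p * of_real r ^ length as) *
       (\<Prod>\<alpha>\<leftarrow>map (\<lambda>\<alpha>. (\<alpha> - x) / of_real r) as. max 1 (cmod \<alpha>))"
    by (simp only: mahler_measure_poly_explicit)
  also have "\<dots> = cmod (lead_coeff p) *
      (r ^ length as * (\<Prod>\<alpha>\<leftarrow>as. max 1 (cmod (\<alpha> - x) / r)))"
    using assms by (simp add: norm_mult norm_power o_def norm_divide)
  also have "r ^ length as * (\<Prod>\<alpha>\<leftarrow>as. max 1 (cmod (\<alpha> - x) / r)) = (\<Prod>\<alpha>\<leftarrow>as. max r (cmod (\<alpha> - x)))" for as
  proof (induction as)
    case (Cons a as)
    have "r * max 1 (cmod (a - x) / r) = max r (cmod (a - x))"
      using assms by (auto simp: max_def field_simps)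
    thus ?case by (simp add: Cons.IH[symmetric] mult_ac)
  qed simp
  also have "(\<Prod>\<alpha>\<leftarrow>as. max r (cmod (\<alpha> - x))) = (\<Prod>\<alpha>\<in>#proots p. max r (cmod (\<alpha> - x)))"
    by (simp only: as[symmetric] mset_map[symmetric] prod_mset_prod_list)
  finally show ?thesis .
qed

lemma log_measure_mahler:
  assumes "r > 0" "F \<noteq> 0"
  shows "log_measure x r F =
    real (degree F) * ln 2 + ln (mahler_measure_poly (of_int_poly F \<circ>\<^sub>p [:x, of_real r:]))"
proof -
  let ?M = "proots (of_int_poly F :: complex poly)"
  have pos: "0 < max r (cmod (\<alpha> - x))" for \<alpha> using assms by auto
  have "(\<Sum>\<alpha>\<in>#?M. ln (2 * max r (cmod (\<alpha> - x)))) =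
      (\<Sum>\<alpha>\<in>#?M. ln 2 + ln (max r (cmod (\<alpha> - x))))"
    using pos by (simp only: ln_mult_pos zero_less_numeral)
  also have "\<dots> = real (degree F) * ln 2 + (\<Sum>\<alpha>\<in>#?M. ln (max r (cmod (\<alpha> - x))))"
    by (simp add: sum_mset.distrib size_proots_complex)
  also have "(\<Sum>\<alpha>\<in>#?M. ln (max r (cmod (\<alpha> - x)))) = ln (\<Prod>\<alpha>\<in>#?M. max r (cmod (\<alpha> - x)))"
    using ln_prod_mset(1)[of ?M "\<lambda>\<alpha>. max r (cmod (\<alpha> - x))"] pos by simp
  finally have sum: "(\<Sum>\<alpha>\<in>#?M. ln (2 * max r (cmod (\<alpha> - x)))) =
      real (degree F) * ln 2 + ln (\<Prod>\<alpha>\<in>#?M. max r (cmod (\<alpha> - x)))" .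
  have "ln (\<bar>real_of_int (lead_coeff F)\<bar> * (\<Prod>\<alpha>\<in>#?M. max r (cmod (\<alpha> - x)))) =
      ln \<bar>real_of_int (lead_coeff F)\<bar> + ln (\<Prod>\<alpha>\<in>#?M. max r (cmod (\<alpha> - x)))"
    by (rule ln_mult_pos) (use assms ln_prod_mset(2)[of ?M "\<lambda>\<alpha>. max r (cmod (\<alpha> - x))"] pos in auto)
  thus ?thesis using assms(1) by (simp add: log_measure_def mahler_pcompose sum)
qed

text \<open>Landau's inequality bounds the Mahler measure by the l2 norm of the coefficients; the
  resulting square root of \<open>n + 1\<close> is relaxed to \<open>n + 1\<close>.\<close>

lemma Landau_sup:
  fixes p :: "complex poly"
  assumes "degree p \<le> n" "\<And>j. cmod (coeff p j) \<le> B"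
  shows "mahler_measure_poly p \<le> (real n + 1) * B"
proof -
  have B0: "0 \<le> B" using assms(2)[of 0] norm_ge_zero order_trans by blast
  have len: "real (length (coeffs p)) \<le> real n + 1"
    using assms(1) by (cases "p = 0") (auto simp: length_coeffs_degree)
  have "(\<Sum>a\<leftarrow>coeffs p. (cmod a)\<^sup>2) \<le> (\<Sum>a\<leftarrow>coeffs p. B\<^sup>2)"
  proof (rule sum_list_mono)
    fix a assume "a \<in> set (coeffs p)"
    then obtain j where "a = coeff p j" by (metis coeffs_nth in_set_conv_nth length_coeffs_degree
       less_Suc_eq_le list.size(3) not_less_zero coeffs_0_eq_Nil)
    thus "(cmod a)\<^sup>2 \<le> B\<^sup>2" using assms(2) by (simp add: power_mono)
  qed
  also have "\<dots> = real (length (coeffs p)) * B\<^sup>2" by (simp add: sum_list_triv)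
  also have "\<dots> \<le> (real n + 1) * B\<^sup>2" using len by (intro mult_right_mono) auto
  also have "\<dots> \<le> (real n + 1)\<^sup>2 * B\<^sup>2"
    by (intro mult_right_mono) (auto simp: power2_eq_square)
  finally have "l2norm_complex p \<le> sqrt (((real n + 1) * B)\<^sup>2)"
    by (simp add: power_mult_distrib)
  also have "\<dots> = (real n + 1) * B" using B0 by simp
  finally show ?thesis using Landau_inequality[of p] by simp
qed

text \<open>This is how smallness of a polynomial on a disc enters. The factor \<open>2 ^ n\<close>
  pays for the 2 at each root in \<open>log_measure\<close>.\<close>

lemma log_measure_le:
  assumes "r > 0" "F \<noteq> 0" "degree F \<le> n"
    "\<And>j. cmod (coeff (of_int_poly F \<circ>\<^sub>p [:x, of_real r:]) j) \<le> B"
  shows "log_measure x r F \<le> ln (2 ^ n * (real n + 1) * B)"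
proof -
  let ?p = "of_int_poly F \<circ>\<^sub>p [:x, of_real r:] :: complex poly"
  have dp: "degree ?p = degree F" using assms(1) by (simp add: degree_pcompose)
  have pos: "0 < mahler_measure_poly ?p"
  proof -
    have "0 < max r (cmod (\<alpha> - x))" for \<alpha> using assms by auto
    hence "0 < (\<Prod>\<alpha>\<in>#proots (of_int_poly F). max r (cmod (\<alpha> - x)))" by (intro ln_prod_mset(2))
    thus ?thesis using assms(1,2) by (simp add: mahler_pcompose del: prod_mset_zero_iff)
  qed
  have le: "mahler_measure_poly ?p \<le> (real n + 1) * B"
    by (rule Landau_sup) (use assms dp in auto)
  have "real (degree F) * ln 2 \<le> real n * ln 2" using assms(3) by simp
  hence "log_measure x r F \<le> real n * ln 2 + ln ((real n + 1) * B)"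
    using log_measure_mahler[OF assms(1,2), of x] pos le by (simp add: add_mono)
  also have "\<dots> = ln (2 ^ n * ((real n + 1) * B))"
    using pos le by (subst ln_mult) (auto simp: ln_realpow)
  finally show ?thesis by (simp add: mult.assoc)
qed

section \<open>Sets of polynomials with controlled differences\<close>

definition diffs :: "int poly set \<Rightarrow> int poly set" where
  "diffs A = {P - Q | P Q. P \<in> A \<and> Q \<in> A \<and> P \<noteq> Q}"

text \<open>The analogue of a linear system without fixed component. Each \<open>F\<close> demands
  an existing difference, so sets with fewer than two elements fail it.\<close>

definition no_common_divisor :: "int poly set \<Rightarrow> bool" where
  "no_common_divisor A \<longleftrightarrow> (\<forall>F. degree F > 0 \<longrightarrow> (\<exists>R\<in>diffs A. \<not> F dvd R))"

lemma diffs_nonzero: "R \<in> diffs A \<Longrightarrow> R \<noteq> 0"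
  by (auto simp: diffs_def)

lemma no_common_divisor_nonempty:
  assumes "no_common_divisor A"
  shows "diffs A \<noteq> {}"
proof -
  have "degree [:0, 1 :: int:] > 0" by simp
  thus ?thesis using assms unfolding no_common_divisor_def by blast
qed

text \<open>Counted from their minimum, the values of \<open>f\<close> lie among at most
  \<open>exp L + 1 \<le> 2 * exp L\<close> consecutive integers; then pigeonhole.\<close>

lemma exists_large_fibre:
  fixes A :: "'a set" and f :: "'a \<Rightarrow> int"
  assumes "finite A" "A \<noteq> {}" "0 \<le> L"
    and "\<And>a b. a \<in> A \<Longrightarrow> b \<in> A \<Longrightarrow> f a \<noteq> f b \<Longrightarrow> \<bar>real_of_int (f a - f b)\<bar> \<le> exp L"
  obtains c where "real (card A) \<le> 2 * exp L * card {a \<in> A. f a = c}" "{a \<in> A. f a = c} \<noteq> {}"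
proof -
  define m where "m = Min (f ` A)"
  have fin: "finite (f ` A)" "f ` A \<noteq> {}" using assms by auto
  have e1: "1 \<le> exp L" using assms(3) by simp
  obtain a0 where a0: "a0 \<in> A" "f a0 = m" using Min_in[OF fin] unfolding m_def by auto
  have sub: "f ` A \<subseteq> {m..m + \<lfloor>exp L\<rfloor>}"
  proof
    fix y assume "y \<in> f ` A"
    then obtain a where a: "a \<in> A" "y = f a" by auto
    have "m \<le> y" unfolding m_def using fin a by auto
    moreover have "real_of_int (y - m) \<le> exp L"
    proof (cases "y = m")
      case False
      thus ?thesis using assms(4)[of a a0] a a0 by auto
    qed simp
    hence "y - m \<le> \<lfloor>exp L\<rfloor>" by (simp only: le_floor_iff)
    ultimately show "y \<in> {m..m + \<lfloor>exp L\<rfloor>}" by simp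
  qed
  have "card (f ` A) \<le> card {m..m + \<lfloor>exp L\<rfloor>}" by (rule card_mono) (use sub in auto)
  also have "\<dots> = nat (\<lfloor>exp L\<rfloor> + 1)" by simp
  finally have "real (card (f ` A)) \<le> real (nat (\<lfloor>exp L\<rfloor> + 1))" by linarith
  also have "\<dots> \<le> exp L + 1" by (simp add: of_nat_nat add_nonneg_nonneg)
  also have "\<dots> \<le> 2 * exp L" using e1 by simp
  finally have card: "real (card (f ` A)) \<le> 2 * exp L" .
  obtain c where c: "c \<in> f ` A" "card A \<le> card (f -` {c} \<inter> A) * card (f ` A)"
    using pigeonhole_card[of f A "f ` A"] assms(1) fin by auto
  have eq: "f -` {c} \<inter> A = {a \<in> A. f a = c}" by auto
  have "real (card A) \<le> real (card {a \<in> A. f a = c}) * real (card (f ` A))"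
    using c(2) unfolding eq by (metis of_nat_le_iff of_nat_mult)
  also have "\<dots> \<le> real (card {a \<in> A. f a = c}) * (2 * exp L)"
    using card by (intro mult_left_mono) auto
  finally have "real (card A) \<le> 2 * exp L * card {a \<in> A. f a = c}" by (simp add: mult_ac)
  moreover have "{a \<in> A. f a = c} \<noteq> {}" using c(1) by auto
  ultimately show ?thesis using that by blast
qed

text \<open>In the notation of the header: \<open>D\<^sup>2 \<ge> 0\<close> up to \<open>2 * L\<close>, obtained by pairing \<open>D\<close> with a single
  difference \<open>R\<close>. The correction is needed for \<open>k \<le> 1\<close>, where \<open>R\<close> cannot have two roots in the disc.\<close>

lemma effective_class_bound:
  fixes l L t r \<sigma> :: real and k d :: nat
  assumes "0 < l" "d \<le> k" "0 \<le> r" "r \<le> L" "0 \<le> \<sigma>" "\<sigma> \<le> l * d" "r - \<sigma> \<le> L - t"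
    and "t * \<sigma> \<le> l * (k * r + d * L)" "0 \<le> t" "t \<le> 2 * l"
  shows "t\<^sup>2 \<le> 2 * l * (k * L + L)"
proof -
  have L0: "0 \<le> L" using assms by linarith
  \<comment> \<open>Because \<open>t \<le> 2 * l\<close>, the inequality \<open>k * l < t\<close>
    leaves only \<open>k \<le> 1\<close>.\<close>
  consider "t \<le> k * l" | "k * l < t" "k = 0" | "k * l < t" "k = 1"
  proof -
    assume a: "t \<le> k * l \<Longrightarrow> thesis" "k * l < t \<Longrightarrow> k = 0 \<Longrightarrow> thesis" "k * l < t \<Longrightarrow> k = 1 \<Longrightarrow> thesis"
    have "t \<le> k * l" if "k \<ge> 2"
    proof -
      have "2 * l \<le> k * l" using that assms(1) by simp
      thus ?thesis using assms(10) by linarith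
    qed
    thus thesis using a by (cases "k \<ge> 2"; cases "t \<le> k * l") (auto simp: not_le less_2_cases_iff)
  qed
  thus ?thesis
  proof cases
    case 1
    have "t * (t - L + r) \<le> t * \<sigma>" using assms by (intro mult_left_mono) auto
    also have "\<dots> \<le> l * (k * r + d * L)" by fact
    also have "\<dots> \<le> l * (k * r + k * L)"
      using assms L0 by (intro mult_left_mono add_left_mono mult_right_mono) auto
    finally have "t * (t - L + r) \<le> l * (k * r + k * L)" .
    \<comment> \<open>Adding this product eliminates \<open>r\<close> and leaves
      \<open>t\<^sup>2 \<le> 2 * l * k * L\<close>.\<close>
    moreover have "0 \<le> (k * l - t) * (L - r)" using 1 assms by simp
    moreover have "0 \<le> l * L" using assms(1) L0 by simp
    ultimately show ?thesis by (simp add: algebra_simps power2_eq_square)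
  next
    case 2
    hence "d = 0" using assms by simp
    hence "\<sigma> = 0" using assms by simp
    hence "t \<le> L" using assms by linarith
    hence "t * t \<le> 2 * l * L" using assms by (intro mult_mono) auto
    thus ?thesis using 2 by (simp add: power2_eq_square)
  next
    case 3
    have "l * \<sigma> \<le> t * \<sigma>" using 3 assms by (intro mult_right_mono) auto
    also have "\<dots> \<le> l * (1 * r + d * L)" using assms 3 by simp
    also have "\<dots> \<le> l * (1 * r + 1 * L)"
      using assms L0 3 by (intro mult_left_mono add_left_mono mult_right_mono) auto
    finally have "\<sigma> \<le> r + L" using assms(1) by simp
    hence "t \<le> 2 * L" using assms by linarith
    hence "t * t \<le> 2 * l * (2 * L)" using assms by (intro mult_mono) auto
    thus ?thesis using 3 by (simp add: power2_eq_square)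
  qed
qed

section \<open>Closeness to the centre and the intersection form\<close>

context
  fixes x :: complex and \<delta> :: real
  assumes \<delta>: "0 < \<delta>" "\<delta> < 1"
begin

abbreviation (input) "hgt \<equiv> log_measure x 1"

text \<open>By \<open>closeness_sum\<close>, a root within \<open>\<delta>\<close> of
  \<open>x\<close> contributes \<open>- ln \<delta>\<close> and a root at distance at least 1
  contributes 0.\<close>

definition closeness :: "int poly \<Rightarrow> real" where
  "closeness F = hgt F - log_measure x \<delta> F"

abbreviation (input) "cl \<equiv> closeness"

definition root_closeness :: "complex \<Rightarrow> real" where
  "root_closeness \<alpha> = ln (2 * max 1 (cmod (\<alpha> - x))) - ln (2 * max \<delta> (cmod (\<alpha> - x)))"

lemma root_closeness_bounds: "0 \<le> root_closeness \<alpha>" "root_closeness \<alpha> \<le> - ln \<delta>"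
proof -
  let ?d = "cmod (\<alpha> - x)"
  have pos: "0 < max \<delta> ?d" "0 < max 1 ?d" using \<delta> by auto
  have "max \<delta> ?d \<le> max 1 ?d" using \<delta> by auto
  thus "0 \<le> root_closeness \<alpha>" unfolding root_closeness_def using pos by (simp add: mult_pos_pos)
  have "\<delta> * max 1 ?d \<le> max \<delta> ?d"
    using \<delta> by (auto simp: max_def mult_left_le_one_le)
  hence "ln (\<delta> * max 1 ?d) \<le> ln (max \<delta> ?d)"
    using pos \<delta> by (subst ln_le_cancel_iff) auto
  thus "root_closeness \<alpha> \<le> - ln \<delta>" unfolding root_closeness_def using pos \<delta> by (simp add: ln_mult)
qed

lemma closeness_sum: "closeness F = (\<Sum>\<alpha>\<in>#proots (of_int_poly F). root_closeness \<alpha>)"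
  by (simp add: closeness_def log_measure_def sum_mset_diff root_closeness_def)

lemma closeness_nonneg: "0 \<le> closeness F"
  unfolding closeness_sum using root_closeness_bounds by (intro sum_mset_lower)

lemma closeness_le: "closeness F \<le> - ln \<delta> * degree F"
  unfolding closeness_sum using sum_mset_upper[OF root_closeness_bounds(2), of "\<lambda>\<alpha>. \<alpha>" "proots (of_int_poly F)"]
  by (simp add: size_proots_complex)

lemma closeness_mult: "F \<noteq> 0 \<Longrightarrow> G \<noteq> 0 \<Longrightarrow> closeness (F * G) = closeness F + closeness G"
  by (simp add: closeness_def log_measure_mult)

text \<open>The distance is at most twice the larger truncated distance to \<open>x\<close>, which
  gains the smaller of the two closenesses over the trivial bound. The minimum is weakened to a
  product because a bilinear term sums over all pairs of roots to a product of closenesses.\<close>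

lemma ln_dist_roots:
  assumes "\<alpha> \<noteq> \<beta>"
  shows "ln (cmod (\<alpha> - \<beta>)) \<le> ln (2 * max 1 (cmod (\<alpha> - x))) + ln (2 * max 1 (cmod (\<beta> - x)))
           - root_closeness \<alpha> * root_closeness \<beta> / (- ln \<delta>)"
proof -
  define A B where "A = ln (2 * max 1 (cmod (\<alpha> - x)))" and "B = ln (2 * max 1 (cmod (\<beta> - x)))"
  define M where "M = max (max \<delta> (cmod (\<alpha> - x))) (max \<delta> (cmod (\<beta> - x)))"
  have l: "0 < - ln \<delta>" using \<delta> by simp
  have "cmod (\<alpha> - \<beta>) \<le> cmod (\<alpha> - x) + cmod (\<beta> - x)"
    using norm_triangle_ineq4[of "\<alpha> - x" "\<beta> - x"] by simp
  also have "\<dots> \<le> 2 * M" unfolding M_def by (auto simp: max_def)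
  finally have "ln (cmod (\<alpha> - \<beta>)) \<le> ln (2 * M)"
    using assms by (intro ln_mono) auto
  also have "ln (2 * M) \<le> max (A - root_closeness \<alpha>) (B - root_closeness \<beta>)"
    unfolding M_def root_closeness_def A_def B_def by (simp add: max_def)
  also have "\<dots> \<le> A + B - min (root_closeness \<alpha>) (root_closeness \<beta>)"
  proof -
    have "0 \<le> A" "0 \<le> B" unfolding A_def B_def by simp_all
    thus ?thesis by (auto simp: max_def min_def)
  qed
  also have "\<dots> \<le> A + B - root_closeness \<alpha> * root_closeness \<beta> / (- ln \<delta>)"
    \<comment> \<open>\<open>min a b \<ge> a * b\<close> on \<open>[0, 1]\<close>, rescaled\<close>
  proof -
    have "root_closeness \<alpha> * root_closeness \<beta> \<le> min (root_closeness \<alpha>) (root_closeness \<beta>) * (- ln \<delta>)"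
    proof (cases "root_closeness \<alpha> \<le> root_closeness \<beta>")
      case True
      hence "root_closeness \<alpha> * root_closeness \<beta> \<le> root_closeness \<alpha> * (- ln \<delta>)" using root_closeness_bounds by (intro mult_left_mono) auto
      thus ?thesis using True by (simp add: min_def)
    next
      case False
      hence "root_closeness \<beta> * root_closeness \<alpha> \<le> root_closeness \<beta> * (- ln \<delta>)" using root_closeness_bounds by (intro mult_left_mono) auto
      thus ?thesis using False by (simp add: min_def mult.commute)
    qed
    hence "root_closeness \<alpha> * root_closeness \<beta> / (- ln \<delta>) \<le> min (root_closeness \<alpha>) (root_closeness \<beta>)"
      using l by (simp only: pos_divide_le_eq)
    thus ?thesis by (rule diff_left_mono)
  qed
  finally show ?thesis by (simp add: A_def B_def)
qed

text \<open>Take logarithms in \<open>res_abs_int_ge_1\<close> and sum \<open>ln_dist_roots\<close>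
  over all pairs of roots. The terms at radius 1 combine with the leading coefficients into
  \<open>hgt\<close>.\<close>

lemma intersection_nonneg:
  assumes "prime S" "R \<noteq> 0" "\<not> S dvd R" "degree S > 0"
  shows "closeness S * closeness R \<le> - ln \<delta> * (real (degree R) * hgt S + real (degree S) * hgt R)"
proof -
  let ?p = "of_int_poly S :: complex poly" and ?q = "of_int_poly R :: complex poly"
  let ?u = "\<lambda>\<alpha>. ln (2 * max 1 (cmod (\<alpha> - x)))"
  have l: "0 < - ln \<delta>" using \<delta> by simp
  have S0: "S \<noteq> 0" using assms(4) by auto
  have sz: "degree (of_int_poly S :: complex poly) = degree S" by simp
  have ge1: "1 \<le> res_abs ?p ?q" by (rule res_abs_int_ge_1) fact+
  \<comment> \<open>A positive product excludes common roots, so \<open>ln_dist_roots\<close>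
    applies and the logarithm of the product splits.\<close>
  have neq: "\<alpha> \<noteq> \<beta>" if "\<alpha> \<in># proots ?p" "\<beta> \<in># proots ?q" for \<alpha> \<beta>
  proof
    assume "\<alpha> = \<beta>"
    hence "0 \<in># image_mset (\<lambda>\<beta>. cmod (\<alpha> - \<beta>)) (proots ?q)" using that by force
    hence "(\<Prod>\<beta>\<in>#proots ?q. cmod (\<alpha> - \<beta>)) = 0" by (simp only: prod_mset_zero_iff)
    hence "0 \<in># image_mset (\<lambda>\<alpha>. \<Prod>\<beta>\<in>#proots ?q. cmod (\<alpha> - \<beta>)) (proots ?p)" using that by force
    hence z: "(\<Prod>\<alpha>\<in>#proots ?p. \<Prod>\<beta>\<in>#proots ?q. cmod (\<alpha> - \<beta>)) = 0" by (simp only: prod_mset_zero_iff)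
    have "res_abs ?p ?q = 0" unfolding res_abs_def z by simp
    thus False using ge1 by simp
  qed
  have inner: "ln (\<Prod>\<beta>\<in>#proots ?q. cmod (\<alpha> - \<beta>)) = (\<Sum>\<beta>\<in>#proots ?q. ln (cmod (\<alpha> - \<beta>)))"
    "0 < (\<Prod>\<beta>\<in>#proots ?q. cmod (\<alpha> - \<beta>))" if "\<alpha> \<in># proots ?p" for \<alpha>
    using ln_prod_mset[of "proots ?q" "\<lambda>\<beta>. cmod (\<alpha> - \<beta>)"] neq[OF that] by auto
  have lnpp: "ln (\<Prod>\<alpha>\<in>#proots ?p. \<Prod>\<beta>\<in>#proots ?q. cmod (\<alpha> - \<beta>)) =
      (\<Sum>\<alpha>\<in>#proots ?p. ln (\<Prod>\<beta>\<in>#proots ?q. cmod (\<alpha> - \<beta>)))"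
     "0 < (\<Prod>\<alpha>\<in>#proots ?p. \<Prod>\<beta>\<in>#proots ?q. cmod (\<alpha> - \<beta>))"
    using ln_prod_mset[of "proots ?p" "\<lambda>\<alpha>. \<Prod>\<beta>\<in>#proots ?q. cmod (\<alpha> - \<beta>)"] inner(2) by auto
  have "(\<Sum>\<alpha>\<in>#proots ?p. ln (\<Prod>\<beta>\<in>#proots ?q. cmod (\<alpha> - \<beta>))) =
      (\<Sum>\<alpha>\<in>#proots ?p. \<Sum>\<beta>\<in>#proots ?q. ln (cmod (\<alpha> - \<beta>)))"
    by (intro arg_cong[of _ _ sum_mset] image_mset_cong) (rule inner)
  also have "\<dots> \<le> (\<Sum>\<alpha>\<in>#proots ?p. \<Sum>\<beta>\<in>#proots ?q. ?u \<alpha> + ?u \<beta> - root_closeness \<alpha> * root_closeness \<beta> / (- ln \<delta>))"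
    by (intro sum_mset_mono ln_dist_roots neq)
  also have "\<dots> = (\<Sum>\<alpha>\<in>#proots ?p. degree R * ?u \<alpha> + (\<Sum>\<beta>\<in>#proots ?q. ?u \<beta>)
      - root_closeness \<alpha> * (closeness R / (- ln \<delta>)))"
  proof -
    have "(\<Sum>\<beta>\<in>#N. ?u \<alpha> + ?u \<beta> - root_closeness \<alpha> * root_closeness \<beta> / (- ln \<delta>)) =
      size N * ?u \<alpha> + (\<Sum>\<beta>\<in>#N. ?u \<beta>) - root_closeness \<alpha> * ((\<Sum>\<beta>\<in>#N. root_closeness \<beta>) / (- ln \<delta>))" for \<alpha> N
      by (induction N) (simp_all add: algebra_simps add_divide_distrib)
    thus ?thesis by (simp add: closeness_sum size_proots_complex)
  qed
  also have "\<dots> = degree R * (\<Sum>\<alpha>\<in>#proots ?p. ?u \<alpha>) + degree S * (\<Sum>\<beta>\<in>#proots ?q. ?u \<beta>)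
      - closeness S * (closeness R / (- ln \<delta>))"
  proof -
    have "(\<Sum>\<alpha>\<in>#N. d * ?u \<alpha> + e - root_closeness \<alpha> * c) =
      d * (\<Sum>\<alpha>\<in>#N. ?u \<alpha>) + size N * e - (\<Sum>\<alpha>\<in>#N. root_closeness \<alpha>) * c" for d e c :: real and N
      by (induction N) (simp_all add: algebra_simps)
    from this[of "real (degree R)" _ _ "proots ?p"] show ?thesis
      by (simp only: closeness_sum[of S] size_proots_complex sz)
  qed
  finally have *: "ln (\<Prod>\<alpha>\<in>#proots ?p. \<Prod>\<beta>\<in>#proots ?q. cmod (\<alpha> - \<beta>)) \<le>
     degree R * (\<Sum>\<alpha>\<in>#proots ?p. ?u \<alpha>) + degree S * (\<Sum>\<beta>\<in>#proots ?q. ?u \<beta>)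
      - closeness S * (closeness R / (- ln \<delta>))" using lnpp by simp
  have "0 \<le> ln (res_abs ?p ?q)" using ge1 by simp
  also have "\<dots> = degree R * ln \<bar>real_of_int (lead_coeff S)\<bar> + degree S * ln \<bar>real_of_int (lead_coeff R)\<bar>
      + ln (\<Prod>\<alpha>\<in>#proots ?p. \<Prod>\<beta>\<in>#proots ?q. cmod (\<alpha> - \<beta>))"
  proof -
    have "ln (a ^ m * b ^ k * P) = m * ln a + k * ln b + ln P"
      if "0 < a" "0 < b" "0 < P" for a b P :: real and m k :: nat
      using that by (simp add: ln_mult_pos ln_realpow)
    from this[OF _ _ lnpp(2)] show ?thesis using S0 assms(2) by (simp add: res_abs_def)
  qed
  finally have "0 \<le> degree R * hgt S + degree S * hgt R - closeness S * (closeness R / (- ln \<delta>))"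
    using * by (simp add: log_measure_def algebra_simps)
  hence "closeness S * closeness R / (- ln \<delta>) \<le> degree R * hgt S + degree S * hgt R"
    by simp
  thus ?thesis using l by (simp only: pos_divide_le_eq mult.commute)
qed

section \<open>Classes of differences: nefness and counting\<close>

text \<open>Since \<open>hgt R - cl R\<close> is the measure at radius \<open>\<delta>\<close>, the
  class bounds the measures at radius 1 by \<open>L\<close> and at radius \<open>\<delta>\<close> by
  \<open>L - t\<close>. A lower bound on \<open>cl R\<close> itself would not follow from small
  coefficients.\<close>

definition in_class :: "nat \<Rightarrow> real \<Rightarrow> real \<Rightarrow> int poly set \<Rightarrow> bool" where
  "in_class k L t A \<longleftrightarrow>
     (\<forall>R\<in>diffs A. degree R \<le> k \<and> hgt R \<le> L \<and> hgt R - cl R \<le> L - t)"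

text \<open>Everything is additive in \<open>G\<close>, so a prime \<open>S\<close> suffices. Some
  difference \<open>R\<close> is not divisible by \<open>S\<close>; it pairs nonnegatively with
  \<open>S\<close> by \<open>intersection_nonneg\<close>, and so does the remainder of the class,
  because \<open>cl S \<le> - ln \<delta> * degree S\<close>.\<close>

lemma in_class_nef:
  assumes "in_class k L t A" "no_common_divisor A" "G \<noteq> 0"
  shows "t * cl G \<le> - ln \<delta> * (real k * hgt G + real (degree G) * L)"
  using \<open>G \<noteq> 0\<close>
proof (induction G rule: prime_divisors_induct)
  have l: "0 < - ln \<delta>" using \<delta> by simp
  have const: "t * cl G \<le> - ln \<delta> * (real k * hgt G + real (degree G) * L)"
    if "degree G = 0" "G \<noteq> 0" for G
  proof -
    have "cl G = 0" using that by (simp add: closeness_def log_measure_const)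
    moreover have "0 \<le> - ln \<delta> * (real k * hgt G)"
      using l log_measure_nonneg[OF that(2), of x] by (intro mult_nonneg_nonneg) auto
    ultimately show ?thesis using that by simp
  qed
  {
    case (unit G)
    then obtain H where "1 = G * H" by (auto elim: dvdE)
    hence "degree (G * H) = 0" "G \<noteq> 0" "H \<noteq> 0" by auto
    hence "degree G = 0" by (simp add: degree_mult_eq)
    thus ?case using const \<open>G \<noteq> 0\<close> by blast
  next
    case (factor S G)
    hence nz: "S \<noteq> 0" "G \<noteq> 0" by auto
    have "t * cl S \<le> - ln \<delta> * (real k * hgt S + real (degree S) * L)"
    proof (cases "degree S = 0")
      case True
      thus ?thesis using const nz by blast
    next
      case False
      then obtain R where R: "R \<in> diffs A" "\<not> S dvd R"
        using assms(2) unfolding no_common_divisor_def by blast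
      have cls: "degree R \<le> k" "hgt R \<le> L" "hgt R - cl R \<le> L - t"
        using assms(1) R(1) by (auto simp: in_class_def)
      have int: "cl S * cl R \<le> - ln \<delta> * (real (degree R) * hgt S + real (degree S) * hgt R)"
        by (rule intersection_nonneg) (use factor R False diffs_nonzero in auto)
      \<comment> \<open>Split \<open>t\<close> into the part carried by \<open>R\<close> and the
        slack \<open>L - hgt R\<close>.\<close>
      have "t * cl S \<le> (L - hgt R + cl R) * cl S"
        using cls closeness_nonneg by (intro mult_right_mono) auto
      also have "\<dots> = (L - hgt R) * cl S + cl S * cl R" by (simp add: algebra_simps)
      also have "\<dots> \<le> (L - hgt R) * (- ln \<delta> * degree S) +
          - ln \<delta> * (real (degree R) * hgt S + real (degree S) * hgt R)"
        using cls closeness_le int by (intro add_mono mult_left_mono) auto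
      also have "\<dots> = - ln \<delta> * (real (degree R) * hgt S + real (degree S) * L)"
        by (simp add: algebra_simps)
      also have "\<dots> \<le> - ln \<delta> * (real k * hgt S + real (degree S) * L)"
        using l cls log_measure_nonneg[OF nz(1), of x]
        by (intro mult_left_mono add_right_mono mult_right_mono) auto
      finally show ?thesis .
    qed
    moreover have "t * cl G \<le> - ln \<delta> * (real k * hgt G + real (degree G) * L)"
      using factor nz by blast
    moreover have "- ln \<delta> * (real k * hgt (S * G) + real (degree (S * G)) * L) =
      - ln \<delta> * (real k * hgt S + real (degree S) * L) + - ln \<delta> * (real k * hgt G + real (degree G) * L)"
      using nz by (simp add: log_measure_mult degree_mult_eq algebra_simps)
    moreover have "t * cl (S * G) = t * cl S + t * cl G"
      using nz by (simp add: closeness_mult algebra_simps)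
    ultimately show ?case by linarith
  }
qed simp

text \<open>Strong induction on \<open>k\<close>. Fixing the coefficient of index \<open>k\<close>
  costs a factor \<open>2 * exp L\<close>. The surviving set \<open>A'\<close> is a single point,
  settled by \<open>effective_class_bound\<close>, or its differences divided by a common divisor
  \<open>G\<close> form a class with data \<open>(k - 1 - g, L - e, t - \<tau>)\<close> to which
  induction applies.\<close>

lemma card_in_class_le:
  assumes "finite A" "in_class k L t A" "no_common_divisor A" "0 \<le> t" "t \<le> 2 * - ln \<delta>"
  shows "real (card A) \<le> 2 ^ (k + 1) * exp ((real k + 2) * L - t\<^sup>2 / (2 * - ln \<delta>))"
  using assms
proof (induction k arbitrary: A L t rule: less_induct)
  case (less k)
  define l where "l = - ln \<delta>"
  have l: "0 < l" using \<delta> by (simp add: l_def)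
  obtain R where R: "R \<in> diffs A" using no_common_divisor_nonempty less.prems(3) by blast
  have cls: "degree R \<le> k" "hgt R \<le> L" "hgt R - cl R \<le> L - t" if "R \<in> diffs A" for R
    using less.prems(2) that by (auto simp: in_class_def)
  have L0: "0 \<le> L" using cls(2)[OF R] log_measure_nonneg[OF diffs_nonzero[OF R]] order_trans by blast
  have A0: "A \<noteq> {}" using R by (auto simp: diffs_def)
  \<comment> \<open>If the coefficients of index \<open>k\<close> differ, their difference is the
    leading coefficient of \<open>P - Q\<close>.\<close>
  have sep: "\<bar>real_of_int (coeff P k - coeff Q k)\<bar> \<le> exp L"
    if "P \<in> A" "Q \<in> A" "coeff P k \<noteq> coeff Q k" for P Q
  proof -
    have d: "P - Q \<in> diffs A" using that by (auto simp: diffs_def)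
    have "coeff (P - Q) k \<noteq> 0" using that by simp
    hence "degree (P - Q) = k" using cls(1)[OF d] le_degree le_antisym by blast
    hence "ln \<bar>real_of_int (coeff P k - coeff Q k)\<bar> \<le> L"
      using ln_lead_coeff_le_log_measure[OF diffs_nonzero[OF d], of x] cls(2)[OF d] by simp
    hence "exp (ln \<bar>real_of_int (coeff P k - coeff Q k)\<bar>) \<le> exp L" by simp
    thus ?thesis using that by simp
  qed
  obtain c where c: "real (card A) \<le> 2 * exp L * card {P \<in> A. coeff P k = c}"
      "{P \<in> A. coeff P k = c} \<noteq> {}"
    using exists_large_fibre[OF less.prems(1) A0 L0, of "\<lambda>P. coeff P k"] sep by blast
  define A' where "A' = {P \<in> A. coeff P k = c}"
  have finA': "finite A'" using less.prems(1) by (simp add: A'_def)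
  show ?case
  proof (cases "diffs A' = {}")
    case True
    obtain P0 where "P0 \<in> A'" using c(2) by (auto simp: A'_def)
    hence "A' = {P0}" using True by (auto simp: diffs_def)
    hence "real (card A) \<le> 2 * exp L" using c(1) by (simp add: A'_def)
    \<comment> \<open>The difference \<open>R\<close> comes from \<open>A\<close>, as
      \<open>A'\<close> has none left.\<close>
    also have "t\<^sup>2 \<le> 2 * l * (k * L + L)"
      using effective_class_bound[of l "degree R" k "hgt R" L "cl R" t] l cls[OF R]
        log_measure_nonneg[OF diffs_nonzero[OF R]] closeness_nonneg closeness_le[of R]
        in_class_nef[OF less.prems(2,3) diffs_nonzero[OF R]] less.prems(4,5)
      by (simp add: l_def)
    hence "t\<^sup>2 / (2 * l) \<le> k * L + L" using l by (simp add: divide_le_eq mult.commute)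
    hence "L \<le> (real k + 2) * L - t\<^sup>2 / (2 * l)" by (simp add: algebra_simps)
    hence "2 * exp L \<le> 2 ^ (k + 1) * exp ((real k + 2) * L - t\<^sup>2 / (2 * l))"
      by (intro mult_mono) auto
    finally show ?thesis by (simp add: l_def)
  next
    case False
    have sub: "diffs A' \<subseteq> diffs A" by (auto simp: diffs_def A'_def)
    have degA': "degree R < k" if "R \<in> diffs A'" for R
    proof -
      have "coeff R k = 0" using that by (auto simp: diffs_def A'_def)
      hence "degree R \<noteq> k" using diffs_nonzero[OF that] by (metis leading_coeff_0_iff)
      thus ?thesis using cls(1)[of R] that sub by fastforce
    qed
    obtain R1 where R1: "R1 \<in> diffs A'" using False by blast
    let ?D = "\<lambda>G. \<forall>R\<in>diffs A'. G dvd R"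
    have D0: "G \<noteq> 0" "degree G \<le> degree R1" if "?D G" for G
      using that R1 diffs_nonzero[OF R1] by (auto intro: dvd_imp_degree_le)
    \<comment> \<open>A common divisor of maximal degree; the degrees are bounded by that of
      \<open>R1\<close>, and \<open>Suc\<close> makes the bound strict.\<close>
    have "\<exists>G. ?D G \<and> (\<forall>H. ?D H \<longrightarrow> degree H \<le> degree G)"
    proof (rule ex_has_greatest_nat[where P = ?D and f = degree and k = 1 and b = "Suc (degree R1)"])
      show "?D 1" by simp
      show "\<forall>H. ?D H \<longrightarrow> degree H < Suc (degree R1)"
        by (intro allI impI le_imp_less_Suc) (rule D0(2))
    qed
    then obtain G where G: "?D G" "\<And>H. ?D H \<Longrightarrow> degree H \<le> degree G" by (elim exE conjE) metis
    have G0: "G \<noteq> 0" using D0 G by blast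
    \<comment> \<open>A base point in \<open>A'\<close> lets the division by \<open>G\<close> act on
      elements and not only on differences.\<close>
    obtain P0 where P0: "P0 \<in> A'" using c(2) by (auto simp: A'_def)
    define q where "q = (\<lambda>P. (P - P0) div G)"
    have q: "P = P0 + G * q P" if "P \<in> A'" for P
    proof -
      have "G dvd P - P0"
      proof (cases "P = P0")
        case False
        hence "P - P0 \<in> diffs A'" using that P0 by (auto simp: diffs_def)
        thus ?thesis using G by blast
      qed simp
      thus ?thesis by (simp add: q_def)
    qed
    have "inj_on q A'"
    proof (rule inj_onI)
      fix P Q assume PQ: "P \<in> A'" "Q \<in> A'" "q P = q Q"
      have "P = P0 + G * q P" by (rule q) fact
      also have "\<dots> = P0 + G * q Q" by (simp only: PQ(3))
      also have "\<dots> = Q" by (rule q[symmetric]) fact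
      finally show "P = Q" .
    qed
    define B where "B = q ` A'"
    have cardB: "card B = card A'" using \<open>inj_on q A'\<close> by (simp add: B_def card_image)
    have diffB: "G * T \<in> diffs A'" if "T \<in> diffs B" for T
    proof -
      obtain P Q where PQ: "P \<in> A'" "Q \<in> A'" "q P \<noteq> q Q" "T = q P - q Q"
        using \<open>T \<in> diffs B\<close> by (auto simp: diffs_def B_def)
      have "P - Q = (P0 + G * q P) - (P0 + G * q Q)" 
        by (rule arg_cong2[where f = minus, OF q[OF PQ(1)] q[OF PQ(2)]])
      also have "\<dots> = G * T" by (simp add: PQ algebra_simps)
      finally have "G * T = P - Q" ..
      moreover have "P \<noteq> Q" using PQ by auto
      ultimately show ?thesis using PQ by (auto simp: diffs_def)
    qed
    have diffA': "\<exists>T\<in>diffs B. R = G * T" if "R \<in> diffs A'" for R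
    proof -
      obtain P Q where PQ: "P \<in> A'" "Q \<in> A'" "P \<noteq> Q" "R = P - Q"
        using \<open>R \<in> diffs A'\<close> by (auto simp: diffs_def)
      have "P - Q = (P0 + G * q P) - (P0 + G * q Q)" 
        by (rule arg_cong2[where f = minus, OF q[OF PQ(1)] q[OF PQ(2)]])
      hence "R = G * (q P - q Q)" by (simp add: PQ algebra_simps)
      moreover have "q P \<noteq> q Q" using calculation diffs_nonzero[OF \<open>R \<in> diffs A'\<close>] by auto
      ultimately show ?thesis using PQ by (auto simp: diffs_def B_def)
    qed
    define g where "g = degree G"
    define e where "e = hgt G"
    define \<tau> where "\<tau> = cl G"
    define k' where "k' = k - 1 - g"
    obtain T1 where T1: "T1 \<in> diffs B" "R1 = G * T1" using diffA'[OF R1] by blast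
    have eq: "degree (G * T) = g + degree T" "hgt (G * T) = e + hgt T" "cl (G * T) = \<tau> + cl T"
      if "T \<in> diffs B" for T
      using G0 diffs_nonzero[OF that]
      by (simp_all add: degree_mult_eq log_measure_mult closeness_mult g_def e_def \<tau>_def)
    have gk: "g + 1 \<le> k" using eq(1)[OF T1(1)] degA'[OF R1] T1 by simp
    have k': "real k' = real k - 1 - real g" "k' < k" using gk by (auto simp: k'_def)
    have e0: "0 \<le> e" "0 \<le> \<tau>" using log_measure_nonneg[OF G0] closeness_nonneg
      by (auto simp: e_def \<tau>_def)
    have clsB: "degree T \<le> k'" "hgt T \<le> L - e" "hgt T - cl T \<le> (L - e) - (t - \<tau>)"
      if "T \<in> diffs B" for T
      using eq[OF that] degA'[OF diffB[OF that]] cls[of "G * T"] diffB[OF that] sub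
      by (auto simp: k'_def)
    have inB: "in_class k' (L - e) (t - \<tau>) B" using clsB by (auto simp: in_class_def)
    \<comment> \<open>The class with \<open>t\<close> replaced by 0 serves the case where
      \<open>t - \<tau>\<close> is negative.\<close>
    have "hgt T - cl T \<le> (L - e) - 0" if "T \<in> diffs B" for T
      using clsB(2)[OF that] closeness_nonneg[of T] by linarith
    hence inB0: "in_class k' (L - e) 0 B" using clsB by (auto simp: in_class_def)
    have eL: "e \<le> L"
      using clsB(2)[OF T1(1)] log_measure_nonneg[OF diffs_nonzero[OF T1(1)], of x] by linarith
    have freeB: "no_common_divisor B"
      unfolding no_common_divisor_def
    \<comment> \<open>A common factor \<open>F\<close> of the quotients would make
      \<open>G * F\<close> a common divisor of larger degree than \<open>G\<close>.\<close>
    proof (intro allI impI, rule ccontr)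
      fix F :: "int poly"
      assume F: "degree F > 0" "\<not> (\<exists>T\<in>diffs B. \<not> F dvd T)"
      have "?D (G * F)"
      proof
        fix R assume "R \<in> diffs A'"
        then obtain T where "T \<in> diffs B" "R = G * T" using diffA' by blast
        thus "G * F dvd R" using F by (auto intro: mult_dvd_mono)
      qed
      hence "degree (G * F) \<le> degree G" using G by blast
      moreover have "F \<noteq> 0" using F by auto
      ultimately show False using F G0 by (simp add: degree_mult_eq)
    qed
    have finB: "finite B" using finA' by (simp add: B_def)
    have nef: "t * \<tau> \<le> l * (real k * e + real g * L)"
      using in_class_nef[OF less.prems(2,3) G0] by (simp add: \<tau>_def e_def g_def l_def)
    have nefB: "(t - \<tau>) * \<tau> \<le> l * (real k' * e + real g * (L - e))"
      using in_class_nef[OF inB freeB G0] by (simp add: \<tau>_def e_def g_def l_def)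
    have tl: "\<tau> \<le> t \<Longrightarrow> t - \<tau> \<le> 2 * - ln \<delta>" using e0 less.prems(5) by simp
    \<comment> \<open>\<open>E\<close> is the exponent from the induction hypothesis; the added
      \<open>L\<close> is the cost of fixing one coefficient.\<close>
    have "\<exists>E. real (card B) \<le> 2 ^ (k' + 1) * exp E \<and> L + E \<le> (real k + 2) * L - t\<^sup>2 / (2 * l)"
    proof (cases "\<tau> \<le> t")
      case True
      have "real (card B) \<le> 2 ^ (k' + 1) * exp ((real k' + 2) * (L - e) - (t - \<tau>)\<^sup>2 / (2 * l))"
        using less.IH[OF k'(2) finB inB freeB] True tl by (simp add: l_def)
      \<comment> \<open>The factor before \<open>2 * l\<close> is
        \<open>(k + 1) * L - (k' + 2) * (L - e)\<close>, the drop of the linear part of the exponent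
        after paying \<open>L\<close>.\<close>
      moreover have "t\<^sup>2 - (t - \<tau>)\<^sup>2 \<le> ((real g * L + (real k + 1) * e - real g * e)) * (2 * l)"
      proof -
        have "t\<^sup>2 - (t - \<tau>)\<^sup>2 = t * \<tau> + (t - \<tau>) * \<tau>"
          by (simp add: power2_eq_square algebra_simps)
        also have "\<dots> \<le> l * (real k * e + real g * L) + l * (real k' * e + real g * (L - e))"
          \<comment> \<open>pair \<open>G\<close> with the class before and after the division\<close>
          using nef nefB by (rule add_mono)
        also have "\<dots> = (real g * L + (real k + 1) * e - real g * e) * (2 * l) - 3 * (l * e)"
          by (simp add: k' algebra_simps)
        also have "\<dots> \<le> (real g * L + (real k + 1) * e - real g * e) * (2 * l)"
          using l e0 by simp
        finally show ?thesis .
      qed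
      hence "(t\<^sup>2 - (t - \<tau>)\<^sup>2) / (2 * l) \<le> real g * L + (real k + 1) * e - real g * e"
        using l by (simp only: pos_divide_le_eq mult_pos_pos zero_less_numeral)
      hence "L + ((real k' + 2) * (L - e) - (t - \<tau>)\<^sup>2 / (2 * l)) \<le> (real k + 2) * L - t\<^sup>2 / (2 * l)"
        by (simp add: k' diff_divide_distrib algebra_simps)
      ultimately show ?thesis by blast
    next
      case False
      \<comment> \<open>Here \<open>G\<close> alone has closeness above \<open>t\<close>: the
        remaining closeness is given up, and nefness against \<open>G\<close> pays for all of
        \<open>t\<^sup>2\<close>.\<close>
      have "real (card B) \<le> 2 ^ (k' + 1) * exp ((real k' + 2) * (L - e) - 0\<^sup>2 / (2 * - ln \<delta>))"
        by (rule less.IH[OF k'(2) finB inB0 freeB]) (use l in \<open>auto simp: l_def\<close>)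
      hence "real (card B) \<le> 2 ^ (k' + 1) * exp ((real k' + 2) * (L - e))" by simp
      moreover have "t\<^sup>2 \<le> (real g * L + (real k + 1) * e - real g * e) * (2 * l)"
      proof -
        have "t\<^sup>2 \<le> t * \<tau>" using False less.prems(4) by (simp add: power2_eq_square mult_left_mono)
        also have "\<dots> \<le> l * (real k * e + real g * L)" by (rule nef)
        finally have 1: "t\<^sup>2 \<le> l * (real k * e + real g * L)" .
        have "real g * e \<le> real g * L" using eL by (intro mult_left_mono) auto
        moreover have "real g * e \<le> real k * e" using gk e0 by (intro mult_right_mono) auto
        ultimately have "real k * e + real g * L \<le> 2 * (real g * L + (real k + 1) * e - real g * e)"
          using e0 by (simp add: algebra_simps)
        hence "l * (real k * e + real g * L) \<le> l * (2 * (real g * L + (real k + 1) * e - real g * e))"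
          using l by (intro mult_left_mono) auto
        thus ?thesis using 1 by (simp add: algebra_simps)
      qed
      hence "t\<^sup>2 / (2 * l) \<le> real g * L + (real k + 1) * e - real g * e"
        using l by (simp only: pos_divide_le_eq mult_pos_pos zero_less_numeral)
      hence "L + (real k' + 2) * (L - e) \<le> (real k + 2) * L - t\<^sup>2 / (2 * l)"
        by (simp add: k' algebra_simps)
      ultimately show ?thesis by blast
    qed
    then obtain E where E: "real (card B) \<le> 2 ^ (k' + 1) * exp E"
      "L + E \<le> (real k + 2) * L - t\<^sup>2 / (2 * l)" by blast
    have "real (card A) \<le> 2 * exp L * real (card B)" using c(1) by (simp add: cardB A'_def)
    also have "\<dots> \<le> 2 * exp L * (2 ^ (k' + 1) * exp E)" using E(1) by (intro mult_left_mono) auto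
    also have "\<dots> = 2 ^ (k' + 2) * exp (L + E)" by (simp add: exp_add)
    also have "\<dots> \<le> 2 ^ (k + 1) * exp ((real k + 2) * L - t\<^sup>2 / (2 * l))"
      using E(2) k'(2) by (intro mult_mono power_increasing) auto
    finally show ?thesis by (simp add: l_def)
  qed
qed

end

section \<open>Polynomials with small derivative at a root\<close>

text \<open>Horner's scheme: each step forms \<open>a + (u + X) * q\<close>, a sum of three terms
  bounded by the previous bound because \<open>cmod u \<le> 1\<close>.\<close>

lemma coeff_shift_le:
  fixes p :: "complex poly"
  assumes "cmod u \<le> 1" "\<And>j. cmod (coeff p j) \<le> B"
  shows "cmod (coeff (p \<circ>\<^sub>p [:u, 1:]) j) \<le> 3 ^ length (coeffs p) * B"
  using assms(2)
proof (induction p arbitrary: j rule: pCons_induct)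
  case 0
  thus ?case by simp
next
  case (pCons a p)
  let ?K = "3 ^ length (coeffs p) * B"
  have B0: "0 \<le> B" using pCons.prems[of 0] norm_ge_zero order_trans by blast
  have a: "cmod a \<le> B" using pCons.prems[of 0] by simp
  have IH: "cmod (coeff (p \<circ>\<^sub>p [:u, 1:]) i) \<le> ?K" for i
    using pCons.prems[of "Suc j" for j] by (intro pCons.IH) simp
  have BK: "B \<le> ?K" using mult_right_mono[of 1 "3 ^ length (coeffs p)" B] B0 by simp
  let ?q = "p \<circ>\<^sub>p [:u, 1:]"
  have eq: "coeff (pCons a p \<circ>\<^sub>p [:u, 1:]) j =
     (if j = 0 then a else 0) + u * coeff ?q j + (if j = 0 then 0 else coeff ?q (j - 1))"
    by (cases j) (simp_all add: pcompose_pCons)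
  have "cmod (u * coeff ?q j) \<le> 1 * ?K"
    unfolding norm_mult using assms(1) IH by (intro mult_mono) auto
  moreover have "cmod (if j = 0 then a else 0) \<le> ?K"
    using a BK B0 by (cases "j = 0") (simp_all add: order_trans[OF B0 BK])
  moreover have "cmod (if j = 0 then 0 else coeff ?q (j - 1)) \<le> ?K"
    using IH[of "j - 1"] order_trans[OF B0 BK] by (cases "j = 0") simp_all
  ultimately have "cmod (coeff (pCons a p \<circ>\<^sub>p [:u, 1:]) j) \<le> 3 * ?K"
    unfolding eq using norm_triangle_ineq[of "(if j = 0 then a else 0) + u * coeff ?q j" "if j = 0 then 0 else coeff ?q (j - 1)"]
      norm_triangle_ineq[of "if j = 0 then a else 0" "u * coeff ?q j"] by linarith
  also have "\<dots> = 3 ^ length (coeffs (pCons a p)) * B"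
    using pCons.hyps by (auto simp: coeffs_pCons_eq_cCons cCons_def)
  finally show ?case .
qed

lemma coeff_shift_le_degree:
  fixes p :: "complex poly"
  assumes "cmod u \<le> 1" "\<And>j. cmod (coeff p j) \<le> B" "degree p \<le> n"
  shows "cmod (coeff (p \<circ>\<^sub>p [:u, 1:]) j) \<le> 3 ^ (n + 1) * B"
proof -
  have B0: "0 \<le> B" using assms(2)[of 0] norm_ge_zero order_trans by blast
  have "length (coeffs p) \<le> n + 1"
    using assms(3) by (cases "p = 0") (auto simp: length_coeffs_degree)
  hence "3 ^ length (coeffs p) * B \<le> 3 ^ (n + 1) * B"
    using B0 by (intro mult_right_mono power_increasing) auto
  thus ?thesis using coeff_shift_le[OF assms(1,2), of j] by linarith
qed

text \<open>Expand at \<open>\<alpha>\<close>: the constant term vanishes, the linear one is at most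
  \<open>Q * \<delta>\<close>, the others are O(Q). Scaling by \<open>\<delta>\<close> makes all of
  them \<open>O(Q * \<delta>\<^sup>2)\<close>. Moving the centre to \<open>x\<close> is then a shift
  by \<open>(x - \<alpha>) / \<delta>\<close>, of modulus at most 1. Two shifts give 9 = 3 *
  3.\<close>

lemma coeff_near_double_root:
  fixes p :: "complex poly"
  assumes "cmod \<alpha> \<le> 1" "cmod (x - \<alpha>) \<le> \<delta>" "0 < \<delta>" "\<delta> \<le> 1"
    and "\<And>j. cmod (coeff p j) \<le> Q" "degree p \<le> n" "poly p \<alpha> = 0" "cmod (poly (pderiv p) \<alpha>) \<le> Q * \<delta>"
  shows "cmod (coeff (p \<circ>\<^sub>p [:x, of_real \<delta>:]) j) \<le> 9 ^ (n + 1) * (Q * \<delta>\<^sup>2)"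
proof -
  let ?q = "p \<circ>\<^sub>p [:\<alpha>, 1:]"
  have Q0: "0 \<le> Q" using assms(5)[of 0] norm_ge_zero order_trans by blast
  have q0: "coeff ?q 0 = 0" using assms(7) by (simp add: poly_pcompose flip: poly_0_coeff_0)
  have "coeff ?q 1 = poly (pderiv ?q) 0" by (simp add: coeff_pderiv poly_0_coeff_0)
  also have "\<dots> = poly (pderiv p) \<alpha>" by (simp add: pderiv_pcompose poly_pcompose pderiv_pCons)
  finally have q1: "coeff ?q 1 = poly (pderiv p) \<alpha>" .
  have K: "cmod (coeff ?q i * of_real \<delta> ^ i) \<le> 3 ^ (n + 1) * (Q * \<delta>\<^sup>2)" for i
  proof -
    have one: "1 \<le> (3 :: real) ^ (n + 1)" by (rule one_le_power) simp
    consider "i = 0" | "i = 1" | "i \<ge> 2" by linarith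
    thus ?thesis
    proof cases
      case 1
      thus ?thesis using q0 Q0 by simp
    next
      case 2
      have "cmod (coeff ?q 1) * \<delta> \<le> Q * \<delta> * \<delta>"
        using assms q1 by (intro mult_right_mono) auto
      also have "\<dots> \<le> 3 ^ (n + 1) * (Q * \<delta>\<^sup>2)"
        using mult_right_mono[OF one, of "Q * \<delta>\<^sup>2"] Q0 by (simp add: power2_eq_square mult.assoc)
      finally show ?thesis using 2 assms(3) by (simp add: norm_mult)
    next
      case 3
      have "\<delta> ^ i \<le> \<delta>\<^sup>2" using 3 assms by (intro power_decreasing) auto
      hence "cmod (coeff ?q i) * \<delta> ^ i \<le> (3 ^ (n + 1) * Q) * \<delta>\<^sup>2"
        using coeff_shift_le_degree[OF assms(1,5,6), of i] Q0 assms(3) by (intro mult_mono) auto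
      thus ?thesis using assms(3) by (simp add: norm_mult norm_power mult.assoc)
    qed
  qed
  let ?s = "?q \<circ>\<^sub>p [:0, of_real \<delta>:]"
  have s: "coeff ?s i = of_real \<delta> ^ i * coeff ?q i" for i by (rule coeff_pcompose_linear)
  have "?s \<circ>\<^sub>p [:(x - \<alpha>) / of_real \<delta>, 1:] = p \<circ>\<^sub>p [:x, of_real \<delta>:]"
    using assms(3) by (simp add: pcompose_pCons flip: pcompose_assoc)
  moreover have "cmod (coeff (?s \<circ>\<^sub>p [:(x - \<alpha>) / of_real \<delta>, 1:]) j) \<le> 3 ^ (n + 1) * (3 ^ (n + 1) * (Q * \<delta>\<^sup>2))"
  proof (rule coeff_shift_le_degree)
    show "cmod ((x - \<alpha>) / of_real \<delta>) \<le> 1" using assms by (simp add: norm_divide)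
    show "cmod (coeff ?s j) \<le> 3 ^ (n + 1) * (Q * \<delta>\<^sup>2)" for j
      unfolding s mult.commute[of "of_real \<delta> ^ j"] by (rule K)
    show "degree ?s \<le> n" using assms(3,6) by (simp add: degree_pcompose)
  qed
  moreover have "(3 :: real) ^ (n + 1) * 3 ^ (n + 1) = 9 ^ (n + 1)"
    by (simp flip: power_mult_distrib)
  ultimately show ?thesis by (metis mult.assoc)
qed

section \<open>Counting the polynomials attached to one disc\<close>

text \<open>The root is quantified again so that the same root is near \<open>x\<close> and has
  small derivative.\<close>

definition near :: "nat \<Rightarrow> real \<Rightarrow> real \<Rightarrow> complex \<Rightarrow> int poly set" where
  "near n Q v x = {P \<in> Pset n Q v I0. \<exists>\<alpha>\<in>I0. cmod (\<alpha> - x) \<le> Q powr (-v) \<and>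
     poly (of_int_poly P) \<alpha> = (0::complex) \<and> cmod (poly (pderiv (of_int_poly P)) \<alpha>) < Q powr (1 - v)}"

lemma coeff_le_height:
  assumes "Defs.height P \<le> Q"
  shows "\<bar>real_of_int (coeff P j)\<bar> \<le> Q"
proof -
  let ?S = "{\<bar>real_of_int (coeff P i)\<bar> |i. i \<le> degree P}"
  have eq: "?S = (\<lambda>i. \<bar>real_of_int (coeff P i)\<bar>) ` {..degree P}" by auto
  hence fin: "finite ?S" by simp
  have le: "\<bar>real_of_int (coeff P i)\<bar> \<le> Q" if "i \<le> degree P" for i
  proof -
    have "\<bar>real_of_int (coeff P i)\<bar> \<in> ?S" using that by blast
    hence "\<bar>real_of_int (coeff P i)\<bar> \<le> Max ?S" by (rule Max_ge[OF fin])
    thus ?thesis using assms unfolding Defs.height_def by linarith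
  qed
  show ?thesis
  proof (cases "j \<le> degree P")
    case False
    hence "coeff P j = 0" by (simp add: coeff_eq_0)
    thus ?thesis using le[of 0] abs_ge_zero order_trans by fastforce
  qed (rule le)
qed

text \<open>A nonconstant divisor of an irreducible polynomial is associated to it, so both
  polynomials are associated to \<open>F\<close>; positive leading coefficients turn this into
  equality.\<close>

lemma Pset_dvd_eq:
  assumes "P \<in> Pset n Q v D" "P' \<in> Pset n Q v D" "degree F > 0" "F dvd P" "F dvd P'"
  shows "P = P'"
proof -
  have "\<not> F dvd 1"
  proof
    assume "F dvd 1"
    hence "degree F \<le> degree (1 :: int poly)" by (rule dvd_imp_degree_le) simp
    thus False using assms(3) by simp
  qed
  hence "P dvd F" "P' dvd F"
    using assms by (auto simp: Pset_def dest: irreducibleD')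
  hence "P dvd P'" "P' dvd P" using assms(4,5) dvd_trans by blast+
  hence "normalize P = normalize P'" by (rule normalization_semidom_class.associatedI)
  moreover have "normalize R = R" if "R \<in> Pset n Q v D" for R
  proof -
    have "0 < lead_coeff R" using that unfolding Pset_def by blast
    hence "sgn (lead_coeff R) = 1" by (rule sgn_pos)
    thus ?thesis by (simp add: normalize_poly_def)
  qed
  ultimately show ?thesis using assms(1,2) by metis
qed

text \<open>The factor \<open>2 ^ (n + 1)\<close> comes from \<open>card_in_class_le\<close>; the
  base of the power \<open>n + 2\<close> is the constant \<open>c\<close> with
  \<open>L = ln (c * Q)\<close>.\<close>

definition near_const :: "nat \<Rightarrow> real" where
  "near_const n = 2 ^ (n + 1) * (2 ^ n * (real n + 1) * (2 * 9 ^ (n + 1))) ^ (n + 2)"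

text \<open>Adjoining 0 makes every polynomial of \<open>near\<close> a difference, so two distinct
  ones already exclude a common divisor. With fewer than two, the summand 1 suffices.\<close>

lemma card_near_le:
  assumes Q: "Q > 1" and v: "v > 0" and fin: "finite (Pset n Q v I0)" and x: "cmod x \<le> 1"
  shows "real (card (near n Q v x)) \<le> 1 + near_const n * Q powr (real n + 2 - 2 * v)"
proof (cases "card (near n Q v x) \<le> 1")
  case True
  moreover have "0 \<le> near_const n * Q powr (real n + 2 - 2 * v)" by (simp add: near_const_def)
  ultimately show ?thesis by linarith
next
  case False
  define \<delta> where "\<delta> = Q powr (-v)"
  define M :: real where "M = 9 ^ (n + 1)"
  define c where "c = 2 ^ n * (real n + 1) * (2 * M)"
  define L where "L = ln (c * Q)"
  let ?A = "insert 0 (near n Q v x)"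
  have \<delta>: "0 < \<delta>" "\<delta> < 1" using Q v by (auto simp: \<delta>_def powr_less_one)
  have ln\<delta>: "- ln \<delta> = v * ln Q" using Q by (simp add: \<delta>_def ln_powr)
  have lnQ: "0 < ln Q" using Q by simp
  have c0: "0 < c" by (simp add: c_def M_def)
  have finA: "finite ?A" using fin by (simp add: near_def)
  have M1: "3 ^ (n + 1) \<le> M" unfolding M_def by (intro power_mono) auto
  have bounds: "degree P \<le> n" "cmod (coeff (of_int_poly P \<circ>\<^sub>p [:x, of_real \<delta>:]) j) \<le> M * (Q * \<delta>\<^sup>2)"
     "cmod (coeff (of_int_poly P \<circ>\<^sub>p [:x, of_real 1:]) j) \<le> M * Q" if mem: "P \<in> ?A" for P j
  proof -
    have "degree P \<le> n \<and> cmod (coeff (of_int_poly P \<circ>\<^sub>p [:x, of_real \<delta>:]) j) \<le> M * (Q * \<delta>\<^sup>2) \<and>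
     cmod (coeff (of_int_poly P \<circ>\<^sub>p [:x, of_real 1:]) j) \<le> M * Q"
    proof (cases "P = 0")
      case True
      thus ?thesis using Q by (simp add: M_def)
    next
      case False
      then obtain \<alpha> where P: "P \<in> Pset n Q v I0" and \<alpha>: "\<alpha> \<in> I0" "cmod (\<alpha> - x) \<le> Q powr (-v)"
        "poly (of_int_poly P) \<alpha> = (0::complex)" "cmod (poly (pderiv (of_int_poly P)) \<alpha>) < Q powr (1 - v)"
        using mem by (auto simp: near_def)
      have cf: "cmod (coeff (of_int_poly P) j) \<le> Q" for j
        using P coeff_le_height[of P Q j] by (simp add: Pset_def)
      have deg: "degree P = n" using P by (simp add: Pset_def)
      have \<alpha>1: "cmod \<alpha> \<le> 1" using \<alpha>(1) by (auto simp: I0_def)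
      have "cmod (coeff (of_int_poly P \<circ>\<^sub>p [:x, of_real \<delta>:]) j) \<le> 9 ^ (n + 1) * (Q * \<delta>\<^sup>2)"
      proof (rule coeff_near_double_root[of \<alpha>])
        show "cmod (x - \<alpha>) \<le> \<delta>" using \<alpha>(2) by (simp add: \<delta>_def norm_minus_commute)
        show "cmod (poly (pderiv (of_int_poly P)) \<alpha>) \<le> Q * \<delta>"
          using \<alpha>(4) Q by (simp add: \<delta>_def powr_diff powr_minus divide_simps)
      qed (use \<alpha> \<alpha>1 \<delta> cf deg in auto)
      moreover have "cmod (coeff (of_int_poly P \<circ>\<^sub>p [:x, 1:]) j) \<le> 3 ^ (n + 1) * Q"
        by (rule coeff_shift_le_degree) (use x cf deg in auto)
      hence "cmod (coeff (of_int_poly P \<circ>\<^sub>p [:x, of_real 1:]) j) \<le> M * Q"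
        using mult_right_mono[OF M1, of Q] Q unfolding of_real_1 by linarith
      ultimately show ?thesis using deg by (simp add: M_def)
    qed
    thus "degree P \<le> n" "cmod (coeff (of_int_poly P \<circ>\<^sub>p [:x, of_real \<delta>:]) j) \<le> M * (Q * \<delta>\<^sup>2)"
     "cmod (coeff (of_int_poly P \<circ>\<^sub>p [:x, of_real 1:]) j) \<le> M * Q" by auto
  qed
  have hom: "of_int_poly (P - P') \<circ>\<^sub>p h = of_int_poly P \<circ>\<^sub>p h - of_int_poly P' \<circ>\<^sub>p h"
    for P P' and h :: "complex poly"
    by (simp add: of_int_poly_hom.hom_minus pcompose_diff)
  have cls: "degree R \<le> n" "log_measure x 1 R \<le> L" "log_measure x \<delta> R \<le> L - 2 * - ln \<delta>"
    if "R \<in> diffs ?A" for R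
  proof -
    obtain P P' where P: "P \<in> ?A" "P' \<in> ?A" "R = P - P'"
      using \<open>R \<in> diffs ?A\<close> unfolding diffs_def by blast
    have R0: "R \<noteq> 0" using that by (rule diffs_nonzero)
    show deg: "degree R \<le> n" unfolding P(3) using bounds(1) P by (intro degree_diff_le) auto
    have "cmod (coeff (of_int_poly R \<circ>\<^sub>p [:x, of_real 1:]) j) \<le> 2 * M * Q" for j
      unfolding P(3) hom coeff_diff
      using bounds(3)[OF P(1), of j] bounds(3)[OF P(2), of j]
        norm_triangle_ineq4[of "coeff (of_int_poly P \<circ>\<^sub>p [:x, of_real 1:]) j" "coeff (of_int_poly P' \<circ>\<^sub>p [:x, of_real 1:]) j"]
      by linarith
    from log_measure_le[OF _ R0 deg this] show "log_measure x 1 R \<le> L"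
      by (simp add: L_def c_def mult_ac)
    have "cmod (coeff (of_int_poly R \<circ>\<^sub>p [:x, of_real \<delta>:]) j) \<le> 2 * M * (Q * \<delta>\<^sup>2)" for j
      unfolding P(3) hom coeff_diff
      using bounds(2)[OF P(1), of j] bounds(2)[OF P(2), of j]
        norm_triangle_ineq4[of "coeff (of_int_poly P \<circ>\<^sub>p [:x, of_real \<delta>:]) j" "coeff (of_int_poly P' \<circ>\<^sub>p [:x, of_real \<delta>:]) j"]
      by linarith
    from log_measure_le[OF \<delta>(1) R0 deg this]
    have "log_measure x \<delta> R \<le> ln ((c * Q) * \<delta>\<^sup>2)" by (simp add: c_def mult_ac)
    also have "\<dots> = L - 2 * - ln \<delta>"
      using c0 Q \<delta> by (simp add: L_def ln_mult_pos ln_realpow)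
    finally show "log_measure x \<delta> R \<le> L - 2 * - ln \<delta>" .
  qed
  \<comment> \<open>The value \<open>t = 2 * - ln \<delta>\<close> reflects the bound by
    \<open>Q * \<delta>\<^sup>2\<close>, as for two roots in the disc.\<close>
  have inA: "in_class x \<delta> n L (2 * - ln \<delta>) ?A"
    unfolding in_class_def[OF \<delta>] using cls by (auto simp: closeness_def[OF \<delta>])
  obtain P P' where PP: "P \<in> near n Q v x" "P' \<in> near n Q v x" "P \<noteq> P'"
    using False by (metis card_le_Suc0_iff_eq One_nat_def card.infinite le0)
  have inD: "R \<in> diffs ?A" if "R \<in> near n Q v x" for R
  proof -
    have "R = R - 0" "R \<noteq> 0" using that by (auto simp: near_def Pset_def)
    thus ?thesis unfolding diffs_def using that by blast
  qed
  have free: "no_common_divisor ?A"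
    unfolding no_common_divisor_def
  proof (intro allI impI, rule ccontr)
    fix F :: "int poly"
    assume F: "degree F > 0" "\<not> (\<exists>R\<in>diffs ?A. \<not> F dvd R)"
    hence "F dvd P" "F dvd P'" using inD PP by blast+
    hence "P = P'" using Pset_dvd_eq[of P n Q v I0 P' F] F PP by (auto simp: near_def)
    thus False using PP by simp
  qed
  have "real (card ?A) \<le> 2 ^ (n + 1) * exp ((real n + 2) * L - (2 * - ln \<delta>)\<^sup>2 / (2 * - ln \<delta>))"
    by (rule card_in_class_le[OF \<delta> finA inA free]) (use \<delta> in auto)
  also have "(2 * - ln \<delta>)\<^sup>2 / (2 * - ln \<delta>) = 2 * v * ln Q"
    unfolding ln\<delta> using lnQ v by (simp add: power2_eq_square)
  also have "exp ((real n + 2) * L - 2 * v * ln Q) = c ^ (n + 2) * Q powr (real n + 2 - 2 * v)"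
  proof -
    have "(real n + 2) * L - 2 * v * ln Q = real (n + 2) * ln c + (real n + 2 - 2 * v) * ln Q"
      using c0 Q by (simp add: L_def ln_mult_pos algebra_simps)
    moreover have "exp (real (n + 2) * ln c) = c ^ (n + 2)"
      using c0 by (simp only: exp_of_nat_mult exp_ln)
    ultimately show ?thesis using Q by (simp add: exp_add powr_def)
  qed
  finally have "real (card ?A) \<le> near_const n * Q powr (real n + 2 - 2 * v)"
    by (simp add: near_const_def c_def M_def mult.assoc)
  moreover have "card (near n Q v x) \<le> card ?A" using finA by (intro card_mono) auto
  ultimately show ?thesis by linarith
qed

section \<open>Summation over a cover of the interval\<close>

theorem theorem3:
  fixes n :: nat
  assumes "n \<ge> 3"
  shows "\<exists>c1 Q0. c1 > 0 \<and> Q0 > 0 \<and>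
           (\<forall>Q v. Q > Q0 \<longrightarrow> 1.4 \<le> v \<longrightarrow> v \<le> 7/16 * (real n + 1) \<longrightarrow>
              real (card (Pset n Q v I0)) \<le> c1 * Q powr (real n + 1 - v / 7))"
proof -
  define C where "C = near_const n"
  have C0: "0 < C" by (simp add: C_def near_const_def)
  have main: "real (card (Pset n Q v I0)) \<le> (2 + 2 * C) * Q powr (real n + 1 - v / 7)"
    if Q: "Q > 1" and v: "1.4 \<le> v" "v \<le> 7/16 * (real n + 1)" for Q v
  \<comment> \<open>For an infinite set \<open>card\<close> is 0 and the bound is trivial.\<close>
  proof (cases "finite (Pset n Q v I0)")
    case False
    thus ?thesis using C0 by simp
  next
    case fin: True
    define \<delta> where "\<delta> = Q powr (-v)"
    \<comment> \<open>The centres start at -1/2 with spacing \<open>\<delta>\<close>; the indices up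
      to \<open>N\<close> cover \<open>I0\<close> with at most \<open>2 * Q powr v\<close>
      discs.\<close>
    define N where "N = nat \<lfloor>1 / \<delta>\<rfloor>"
    define x where "x = (\<lambda>j. complex_of_real (- 1/2 + real j * \<delta>))"
    have \<delta>: "0 < \<delta>" using Q by (simp add: \<delta>_def)
    have inv: "1 / \<delta> = Q powr v" using Q by (simp add: \<delta>_def powr_minus divide_simps)
    have inv1: "1 \<le> Q powr v" using Q v by (simp add: ge_one_powr_ge_zero)
    have N: "real N \<le> Q powr v" using inv1 by (simp add: N_def inv)
    have xj: "cmod (x j) \<le> 1" if "j \<le> N" for j
    proof -
      have "real j \<le> 1 / \<delta>" using that N by (simp add: inv)
      hence "real j * \<delta> \<le> 1" using \<delta> by (simp add: le_divide_eq)
      moreover have "0 \<le> real j * \<delta>" using \<delta> by simp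
      ultimately have "\<bar>- 1/2 + real j * \<delta>\<bar> \<le> 1" by linarith
      thus ?thesis unfolding x_def norm_of_real .
    qed
    have "Pset n Q v I0 \<subseteq> (\<Union>j\<in>{..N}. near n Q v (x j))"
    proof
      fix P assume P: "P \<in> Pset n Q v I0"
      then obtain \<alpha> where \<alpha>: "\<alpha> \<in> I0" "poly (of_int_poly P) \<alpha> = (0::complex)"
         "cmod (poly (pderiv (of_int_poly P)) \<alpha>) < Q powr (1 - v)" by (auto simp: Pset_def)
      then obtain a where a: "\<alpha> = complex_of_real a" "-1/2 < a" "a < 1/2" by (auto simp: I0_def)
      define j where "j = nat \<lfloor>(a + 1/2) / \<delta>\<rfloor>"
      have nonneg: "0 \<le> (a + 1/2) / \<delta>" using a \<delta> by simp
      hence j: "real j \<le> (a + 1/2) / \<delta>" "(a + 1/2) / \<delta> < real j + 1" unfolding j_def by linarith+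
      have "(a + 1/2) / \<delta> \<le> 1 / \<delta>" using a \<delta> by (intro divide_right_mono) auto
      hence "j \<le> N" unfolding j_def N_def by (intro nat_mono floor_mono)
      moreover have "cmod (\<alpha> - x j) \<le> \<delta>"
      proof -
        have "real j * \<delta> \<le> a + 1/2" "a + 1/2 < (real j + 1) * \<delta>"
          using j \<delta> by (simp_all add: le_divide_eq divide_less_eq)
        hence "\<bar>a - (- 1/2 + real j * \<delta>)\<bar> \<le> \<delta>" by (simp add: algebra_simps abs_le_iff)
        thus ?thesis unfolding a x_def of_real_diff[symmetric] norm_of_real .
      qed
      ultimately show "P \<in> (\<Union>j\<in>{..N}. near n Q v (x j))"
        using P \<alpha> unfolding near_def \<delta>_def by blast
    qed
    moreover have finn: "finite (near n Q v (x j))" for j using fin by (simp add: near_def)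
    ultimately have "card (Pset n Q v I0) \<le> card (\<Union>j\<in>{..N}. near n Q v (x j))"
      by (intro card_mono) auto
    also have "\<dots> \<le> (\<Sum>j\<in>{..N}. card (near n Q v (x j)))" by (intro card_UN_le) simp
    finally have "real (card (Pset n Q v I0)) \<le> (\<Sum>j\<in>{..N}. real (card (near n Q v (x j))))"
      by (simp flip: of_nat_sum)
    also have "\<dots> \<le> (\<Sum>j\<in>{..N}. 1 + C * Q powr (real n + 2 - 2 * v))"
      unfolding C_def using Q v fin xj by (intro sum_mono card_near_le) auto
    also have "\<dots> = (real N + 1) * (1 + C * Q powr (real n + 2 - 2 * v))" by simp
    also have "\<dots> \<le> (2 * Q powr v) * (1 + C * Q powr (real n + 2 - 2 * v))"
      using N inv1 C0 by (intro mult_right_mono) (auto simp: add_nonneg_nonneg)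
    also have "\<dots> = 2 * Q powr v + 2 * C * Q powr (real n + 2 - v)"
    proof -
      have "Q powr v * Q powr (real n + 2 - 2 * v) = Q powr (real n + 2 - v)"
        by (simp flip: powr_add)
      thus ?thesis by (simp add: algebra_simps)
    qed
    \<comment> \<open>The exponents compare if 8v/7 \<le> n + 1, which the upper bound on
      \<open>v\<close> gives, and 6v/7 \<ge> 1, which \<open>v \<ge> 1.4\<close> gives.\<close>
    also have "\<dots> \<le> 2 * Q powr (real n + 1 - v / 7) + 2 * C * Q powr (real n + 1 - v / 7)"
      using Q v C0 by (intro add_mono mult_left_mono powr_mono) auto
    finally show ?thesis by (simp add: algebra_simps)
  qed
  show ?thesis
    using main C0 by (intro exI[of _ "2 + 2 * C"] exI[of _ 1]) auto
qed

end
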